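(* Let $N,N_0$ be the parameters of the inventory regeneration model described in the context, and let $U=\{N,N-1,\dots,0,-1,\dots,-N_0\}$ be its finite set of admissible reorder levels. For $r\in U$ let $A(r)=E_r[\Delta\gamma]$ be the expected profit on one regeneration period and $B(r)=E_r[\Delta t]$ the expected length of one regeneration period when the reorder level is $r$, and assume $B(r)>0$ for all $r\in U$. Let $\Gamma_d$ be the set of all probability distributions $\alpha=(\alpha_r)_{r\in U}$ on $U$ and consider the optimal control problem $$I_\alpha=\frac{\sum_{r\in U}A(r)\alpha_r}{\sum_{r\in U}B(r)\alpha_r}\to\max,\qquad \alpha\in\Gamma_d.$$ Then an optimal control exists and is deterministic: the function $C(r)=A(r)/B(r)$ attains its global maximum on $U$ at some point $r^*\in U$, and the degenerate distribution $\alpha^*$ concentrated at $r^*$ (that is, $\alpha^*_{r^*}=1$ and $\alpha^*_r=0$ for $r\ne r^*$) is a solution of the problem, so that $\max_{\alpha\in\Gamma_d}I_\alpha=I_{\alpha^*}=A(r^* )/B(r^* )=\max_{r\in U}C(r)$.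
   Context: Model. A warehouse starts each regeneration period with $N$ units of a product. Customers arrive according to a Poisson process of intensity $\lambda>0$, and each demands one unit. Stock levels are integers between $-N_0$ and $N$; a negative level $-k$ means a deficit (deferred demand) of $k$ units. Each arrival lowers the level by one as long as the level is greater than $-N_0$; arrivals occurring when the level is $-N_0$ are lost. With reorder level $r\in U$, a replenishment order is placed when the level reaches $r$ (immediately if $r=N$). It is delivered after a random delay $h_r\ge0$ with distribution function $H_r$, independent of the arrivals. At delivery the stock returns to level $N$ and the period ends. The period length is $\Delta t=S_{N-r}+h_r$, where $S_k$ is the time of the $k$-th arrival ($S_0=0$). Profit. If $n$ is the number of arrivals in the period and $X(t)$ the stock level, then $$\Delta\gamma=(c_0-c_2)\min(n,N+N_0)-c_1\int_0^{\Delta t}\max(X(t),0)\,dt-c_3\int_0^{\Delta t}\max(-X(t),0)\,dt-c_4^{(n-N-N_0)}\mathbf 1_{\{n>N+N_0\}},$$ where $c_0$ is the income per unit sold, $c_1$ the storage cost per unit and unit time, $c_2$ the purchase cost per unit, $c_3$ the deficit cost per unit and unit time, and $c_4^{(i)}$ the cost of losing $i$ customers. Control strategy. At the beginning of each period the reorder level is chosen at random according to $\alpha\in\Gamma_d$, the same for all periods. $E_r$ denotes expectation when the reorder level is $r$. These expectations are assumed to be finite. *)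

theory Defs
  imports "HOL-Probability.Probability"
begin

text \<open>
  A Poisson process is given by its counting process: \<open>K t \<omega>\<close> is the number of arrivals in
  the time interval from \<open>0\<close> to \<open>t\<close>, the right end point included. Only times \<open>t \<ge> 0\<close> matter.
\<close>

definition poisson_process :: "'a measure \<Rightarrow> real \<Rightarrow> (real \<Rightarrow> 'a \<Rightarrow> nat) \<Rightarrow> bool" where
  "poisson_process M rate K \<longleftrightarrow>
     prob_space M \<and>
     (\<forall>t\<ge>0. K t \<in> measurable M (count_space UNIV)) \<and>
     (\<forall>\<omega>\<in>space M. K 0 \<omega> = 0 \<and> mono_on {0..} (\<lambda>t. K t \<omega>) \<and>
        (\<forall>t\<ge>0. continuous (at_right t) (\<lambda>s. K s \<omega>))) \<and>
     (\<forall>s t. 0 \<le> s \<and> s < t \<longrightarrow>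
        distr M (count_space UNIV) (\<lambda>\<omega>. K t \<omega> - K s \<omega>) = measure_pmf (poisson_pmf (rate * (t - s)))) \<and>
     (\<forall>\<tau> :: nat \<Rightarrow> real. 0 \<le> \<tau> 0 \<and> mono \<tau> \<longrightarrow>
        prob_space.indep_vars M (\<lambda>_. count_space UNIV)
          (\<lambda>i \<omega>. K (\<tau> (Suc i)) \<omega> - K (\<tau> i) \<omega>) UNIV)"

definition arrival_time :: "(real \<Rightarrow> 'a \<Rightarrow> nat) \<Rightarrow> nat \<Rightarrow> 'a \<Rightarrow> real" where
  "arrival_time K k \<omega> = Inf {t. 0 \<le> t \<and> k \<le> K t \<omega>}"

definition independent_of_process :: "'a measure \<Rightarrow> ('a \<Rightarrow> real) \<Rightarrow> (real \<Rightarrow> 'a \<Rightarrow> nat) \<Rightarrow> bool" where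
  "independent_of_process M X K \<longleftrightarrow>
     prob_space.indep_set M
       {X -` B \<inter> space M | B. B \<in> sets borel}
       (sigma_sets (space M) {K t -` B \<inter> space M | t B. 0 \<le> t})"

text \<open>
  The data of one regeneration period. The measure \<open>law W r\<close> is the probability law when the
  reorder level is \<open>r\<close>, so that \<open>E\<^sub>r\<close> is the Bochner integral with respect to it.
  The cost of losing \<open>i\<close> customers is \<open>loss_cost W i\<close>.
\<close>

record 'a inventory =
  max_stock :: nat       \<comment> \<open>\<open>N\<close>\<close>
  max_deficit :: nat     \<comment> \<open>\<open>N\<^sub>0\<close>\<close>
  intensity :: real      \<comment> \<open>\<open>\<lambda>\<close>\<close>
  law :: "int \<Rightarrow> 'a measure"
  arrivals :: "real \<Rightarrow> 'a \<Rightarrow> nat"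
  delay :: "int \<Rightarrow> 'a \<Rightarrow> real"
  delay_cdf :: "int \<Rightarrow> real \<Rightarrow> real"
  income :: real         \<comment> \<open>\<open>c\<^sub>0\<close>\<close>
  storage_cost :: real   \<comment> \<open>\<open>c\<^sub>1\<close>\<close>
  purchase_cost :: real  \<comment> \<open>\<open>c\<^sub>2\<close>\<close>
  deficit_cost :: real   \<comment> \<open>\<open>c\<^sub>3\<close>\<close>
  loss_cost :: "nat \<Rightarrow> real"  \<comment> \<open>\<open>c\<^sub>4\<close>\<close>

definition reorder_levels :: "'a inventory \<Rightarrow> int set" where
  "reorder_levels W = {- int (max_deficit W)..int (max_stock W)}"

fun level_after :: "'a inventory \<Rightarrow> nat \<Rightarrow> int" where
  "level_after W 0 = int (max_stock W)"
| "level_after W (Suc k) =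
     (if level_after W k > - int (max_deficit W) then level_after W k - 1 else level_after W k)"

lemma level_after_eq: "level_after W k = max (int (max_stock W) - int k) (- int (max_deficit W))"
  by (induction k) auto

definition stock_level :: "'a inventory \<Rightarrow> 'a \<Rightarrow> real \<Rightarrow> int" where
  "stock_level W \<omega> t = level_after W (arrivals W t \<omega>)"

definition period_length :: "'a inventory \<Rightarrow> int \<Rightarrow> 'a \<Rightarrow> real" where
  "period_length W r \<omega> =
     arrival_time (arrivals W) (nat (int (max_stock W) - r)) \<omega> + delay W r \<omega>"

definition period_profit :: "'a inventory \<Rightarrow> int \<Rightarrow> 'a \<Rightarrow> real" where
  "period_profit W r \<omega> =
     (let T = period_length W r \<omega>;
          n = arrivals W T \<omega>;
          m = max_stock W + max_deficit W
      in (income W - purchase_cost W) * real (min n m)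
         - storage_cost W * (LINT t:{0..T}|lborel. real_of_int (max (stock_level W \<omega> t) 0))
         - deficit_cost W * (LINT t:{0..T}|lborel. real_of_int (max (- stock_level W \<omega> t) 0))
         - (if n > m then loss_cost W (n - m) else 0))"

definition inventory_model :: "'a inventory \<Rightarrow> bool" where
  "inventory_model W \<longleftrightarrow>
     intensity W > 0 \<and>
     (\<forall>r\<in>reorder_levels W.
        poisson_process (law W r) (intensity W) (arrivals W) \<and>
        delay W r \<in> borel_measurable (law W r) \<and>
        (AE \<omega> in law W r. 0 \<le> delay W r \<omega>) \<and>
        cdf (distr (law W r) borel (delay W r)) = delay_cdf W r \<and>
        independent_of_process (law W r) (delay W r) (arrivals W) \<and>
        integrable (law W r) (period_profit W r) \<and>
        integrable (law W r) (period_length W r))"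

definition expected_profit :: "'a inventory \<Rightarrow> int \<Rightarrow> real" where
  "expected_profit W r = (LINT \<omega>|law W r. period_profit W r \<omega>)"

definition expected_length :: "'a inventory \<Rightarrow> int \<Rightarrow> real" where
  "expected_length W r = (LINT \<omega>|law W r. period_length W r \<omega>)"

definition controls :: "'a inventory \<Rightarrow> int pmf set" where
  "controls W = {\<alpha>. set_pmf \<alpha> \<subseteq> reorder_levels W}"

definition profit_rate :: "'a inventory \<Rightarrow> int pmf \<Rightarrow> real" where
  "profit_rate W \<alpha> =
     (\<Sum>r\<in>reorder_levels W. expected_profit W r * pmf \<alpha> r) /
     (\<Sum>r\<in>reorder_levels W. expected_length W r * pmf \<alpha> r)"

definition level_profit_rate :: "'a inventory \<Rightarrow> int \<Rightarrow> real" where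
  "level_profit_rate W r = expected_profit W r / expected_length W r"

end

(* With C the maximum of A/B, A(r) \<le> C B(r) for every r; averaging over the control gives
   numerator \<le> C * denominator. The denominator is positive, and a point mass attains equality. *)
theory Submission
  imports Defs
begin

text \<open>The objective is linear-fractional. Since every B(r) is positive, it is the mean of the
  ratios C(r) = A(r)/B(r) with weights proportional to B(r) \<alpha>_r, so no randomisation can beat
  the largest ratio (\<open>weighted_ratio_le\<close>). A point mass reduces the objective to a
  single ratio (\<open>profit_rate_return_pmf\<close>), so the bound is attained at a maximiser of
  C, which exists because the set of levels is finite and nonempty.\<close>

lemma sum_weighted_pos:
  fixes b w :: "'i \<Rightarrow> real"
  assumes "finite S" "\<And>i. i \<in> S \<Longrightarrow> 0 < b i" "\<And>i. i \<in> S \<Longrightarrow> 0 \<le> w i" "sum w S \<noteq> 0"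
  shows "0 < (\<Sum>i\<in>S. b i * w i)"
proof -
  \<comment> \<open>One strictly positive term suffices, as the others are nonnegative; a nonzero
    total weight supplies it.\<close>
  obtain i where "i \<in> S" "w i \<noteq> 0"
    using \<open>sum w S \<noteq> 0\<close> by (rule sum.not_neutral_contains_not_neutral)
  then have "0 < w i"
    using assms(3)[of i] by linarith
  with \<open>i \<in> S\<close> have "0 < b i * w i"
    by (intro mult_pos_pos assms(2))
  with assms(1) \<open>i \<in> S\<close> show ?thesis
    by (rule sum_pos2) (intro mult_nonneg_nonneg less_imp_le[OF assms(2)] assms(3))
qed

text \<open>Multiplying by \<open>b i > 0\<close> turns each ratio bound into a linear inequality,
  which survives nonnegative weighting and summation; positivity of the summed denominator allows
  dividing back.\<close>

lemma weighted_ratio_le: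
  fixes a b w :: "'i \<Rightarrow> real"
  assumes "finite S" "\<And>i. i \<in> S \<Longrightarrow> 0 < b i" "\<And>i. i \<in> S \<Longrightarrow> 0 \<le> w i" "sum w S \<noteq> 0"
    and ratio: "\<And>i. i \<in> S \<Longrightarrow> a i / b i \<le> c"
  shows "(\<Sum>i\<in>S. a i * w i) / (\<Sum>i\<in>S. b i * w i) \<le> c"
proof -
  have "a i * w i \<le> c * (b i * w i)" if "i \<in> S" for i
  proof -
    have "a i \<le> c * b i"
      using ratio[OF that] assms(2)[OF that] by (simp add: pos_divide_le_eq)
    then have "a i * w i \<le> (c * b i) * w i"
      using assms(3)[OF that] by (rule mult_right_mono)
    then show ?thesis
      by (simp add: mult.assoc)
  qed
  then have "(\<Sum>i\<in>S. a i * w i) \<le> c * (\<Sum>i\<in>S. b i * w i)"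
    unfolding sum_distrib_left by (rule sum_mono)
  then show ?thesis
    using sum_weighted_pos[OF assms(1-4)] by (simp add: pos_divide_le_eq)
qed

text \<open>Membership of \<open>r\<close> matters: for a point mass outside the levels both sums
  vanish, and the quotient is 0 by the convention for division by zero.\<close>

lemma profit_rate_return_pmf:
  assumes "r \<in> reorder_levels W"
  shows "profit_rate W (return_pmf r) = level_profit_rate W r"
proof -
  have "(\<Sum>s\<in>reorder_levels W. f s * pmf (return_pmf r) s) = f r" for f :: "int \<Rightarrow> real"
  proof -
    have "f s * pmf (return_pmf r) s = (if s = r then f s else 0)" for s
      by simp
    then show ?thesis
      using assms by (simp add: reorder_levels_def)
  qed
  then show ?thesis
    by (simp add: profit_rate_def level_profit_rate_def)
qed

theorem mainTheorem2:
  fixes W :: "'a inventory"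
  assumes "inventory_model W"
    and "\<forall>r\<in>reorder_levels W. expected_length W r > 0"
  shows "\<exists>r'\<in>reorder_levels W.
           (\<forall>r\<in>reorder_levels W. level_profit_rate W r \<le> level_profit_rate W r') \<and>
           (\<exists>\<alpha>'\<in>controls W.
              pmf \<alpha>' r' = 1 \<and> (\<forall>r\<in>reorder_levels W. r \<noteq> r' \<longrightarrow> pmf \<alpha>' r = 0) \<and>
              (\<forall>\<alpha>\<in>controls W. profit_rate W \<alpha> \<le> profit_rate W \<alpha>') \<and>
              profit_rate W \<alpha>' = expected_profit W r' / expected_length W r' \<and>
              expected_profit W r' / expected_length W r' = Max (level_profit_rate W ` reorder_levels W))"
proof -
  let ?U = "reorder_levels W"
  let ?C = "level_profit_rate W"
  have fin: "finite ?U" and ne: "?U \<noteq> {}"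
    by (auto simp: reorder_levels_def)
  \<comment> \<open>The maximum of a finite nonempty set belongs to it; this yields the maximiser
    \<open>r'\<close>.\<close>
  have "Max (?C ` ?U) \<in> ?C ` ?U"
    using fin ne by simp
  then obtain r' where r': "r' \<in> ?U" "?C r' = Max (?C ` ?U)"
    by auto
  then have C_le: "?C r \<le> ?C r'" if "r \<in> ?U" for r
    using fin that by simp
  have "profit_rate W \<alpha> \<le> profit_rate W (return_pmf r')" if "\<alpha> \<in> controls W" for \<alpha>
  proof -
    \<comment> \<open>The support of a control lies in \<open>?U\<close>, so all its mass is there;
      this gives the nonzero total weight.\<close>
    have "sum (pmf \<alpha>) ?U = 1"
      using that fin by (intro sum_pmf_eq_1) (auto simp: controls_def)
    then have "profit_rate W \<alpha> \<le> ?C r'"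
      unfolding profit_rate_def using assms(2) fin C_le
      by (intro weighted_ratio_le) (auto simp: level_profit_rate_def)
    then show ?thesis
      using profit_rate_return_pmf[OF r'(1)] by simp
  qed
  moreover have "return_pmf r' \<in> controls W"
    using r' by (simp add: controls_def)
  moreover have "profit_rate W (return_pmf r') = expected_profit W r' / expected_length W r'"
    using profit_rate_return_pmf[OF r'(1)] by (simp add: level_profit_rate_def)
  moreover have "expected_profit W r' / expected_length W r' = Max (?C ` ?U)"
    using r'(2) by (simp add: level_profit_rate_def)
  ultimately show ?thesis
    using r'(1) C_le
    by (intro bexI[of _ r'] conjI bexI[of _ "return_pmf r'"] ballI impI) simp_all
qed

end
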